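(* Let $V$ be a finite-dimensional irreducible $\mathcal{A}$-module of type $B(d)$. Pick $a,b$ among $x,y,z$ with $a\neq b$, and let $c$ denote the element of $\{x,y,z\}$ other than $a,b$. Let $0\neq v^b\in e_0^bV$ and consider the basis $\{e_{i}^{a}v^{b}\}_{i=0}^{d}$ of $V$. With respect to this basis, the matrices representing $a,b,c$ (rows and columns indexed by $0,\dots,d$) are as follows. The matrix representing $a$ is $\mathrm{diag}(d,2-d,d-4,\ldots,4-d,d-2,-d)$, i.e. diagonal with $(i,i)$-entry $(-1)^i(d-2i)$ for $0\le i\le d$. The matrix representing $b$ is tridiagonal with zero diagonal, $(i-1,i)$-entry $d-i+1$ and $(i,i-1)$-entry $i$ for $1\le i\le d$. The matrix representing $c$ is tridiagonal with zero diagonal, $(i-1,i)$-entry $(-1)^{i-1}(d-i+1)$ and $(i,i-1)$-entry $(-1)^{i-1}i$ for $1\le i\le d$.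
   Context: $\mathbb{K}$ is an algebraically closed field of characteristic zero. $\mathcal{A}$ is the unital associative $\mathbb{K}$-algebra with generators $x,y,z$ and relations $xy+yx=2z$, $yz+zy=2x$, $zx+xz=2y$. Type $B(d)$ ($d\ge 0$ even): an $\mathcal{A}$-module is of type $B(d)$ if it is isomorphic to the irreducible module with basis $\{v_i\}_{i=0}^d$ and, for $0\le i\le d$: $x.v_i=(-1)^i(d-2i)v_i$, $y.v_i=(d-i+1)v_{i-1}+(i+1)v_{i+1}$, $z.v_i=(-1)^{i-1}(d-i+1)v_{i-1}+(-1)^i(i+1)v_{i+1}$, with $v_{-1}=0=v_{d+1}$. On a module $V$ of type $B(d)$ each $a\in\{x,y,z\}$ acts diagonalizably with the $d+1$ mutually distinct eigenvalues $\theta_i^a=(-1)^i(d-2i)$, $0\le i\le d$. The primitive idempotent $e_i^a\in\mathrm{End}(V)$ is the projection onto the $\theta_i^a$-eigenspace of $a$ that vanishes on the other eigenspaces of $a$. For $a\ne b$ and $0\ne v^b\in e_0^bV$, the vectors $\{e_i^av^b\}_{i=0}^d$ form a basis of $V$. Convention: the matrix $B$ represents a linear map $T$ with respect to a basis $\{u_i\}_{i=0}^d$ if $Tu_j=\sum_{i=0}^dB_{ij}u_i$ for all $j$. *)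

theory Defs
  imports "HOL-Computational_Algebra.Polynomial" "HOL-Library.Poly_Mapping"
begin

datatype gen = Gx | Gy | Gz

datatype word = Word (letters: "gen list")

instantiation word :: monoid_add
begin
definition "0 = Word []"
definition "u + v = Word (letters u @ letters v)"
instance by standard (simp_all add: zero_word_def plus_word_def)
end

text \<open>Words are written additively because \<open>Poly_Mapping\<close> provides the convolution product
  for additive monoids; \<^typ>\<open>word \<Rightarrow>\<^sub>0 'k\<close> is thus the free unital associative algebra on
  three generators.\<close>

type_synonym 'k free_alg = "word \<Rightarrow>\<^sub>0 'k"

definition fgen :: "gen \<Rightarrow> 'k::field free_alg"
  where "fgen g = Poly_Mapping.single (Word [g]) 1"

definition relators :: "'k::field free_alg set"
  where "relators =
    {fgen Gx * fgen Gy + fgen Gy * fgen Gx - 2 * fgen Gz,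
     fgen Gy * fgen Gz + fgen Gz * fgen Gy - 2 * fgen Gx,
     fgen Gz * fgen Gx + fgen Gx * fgen Gz - 2 * fgen Gy}"

inductive_set rel_ideal :: "'k::field free_alg set"
  where
    base: "r \<in> relators \<Longrightarrow> r \<in> rel_ideal"
  | add: "p \<in> rel_ideal \<Longrightarrow> q \<in> rel_ideal \<Longrightarrow> p + q \<in> rel_ideal"
  | lmult: "p \<in> rel_ideal \<Longrightarrow> a * p \<in> rel_ideal"
  | rmult: "p \<in> rel_ideal \<Longrightarrow> p * a \<in> rel_ideal"

lemma rel_ideal_zero: "0 \<in> rel_ideal"
  using rel_ideal.lmult[OF rel_ideal.base, of _ 0] by (auto simp: relators_def)

lemma rel_ideal_uminus: "p \<in> rel_ideal \<Longrightarrow> - p \<in> rel_ideal"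
  using rel_ideal.lmult[of p "-1"] by simp

lemma free_alg_induct [case_names zero add]:
  fixes p :: "'k::field free_alg"
  assumes "P 0" and "\<And>p w c. P p \<Longrightarrow> P (p + Poly_Mapping.single w c)"
  shows "P p"
proof (induction p rule: update_induct)
  case const
  then show ?case by (rule assms)
next
  case (update p w c)
  have "Poly_Mapping.update w c p = p + Poly_Mapping.single w c"
    using update(1)
    by (intro poly_mapping_eqI) (auto simp: lookup_update lookup_add lookup_single when_def in_keys_iff)
  then show ?case using assms(2) update by metis
qed

locale gen_maps = vector_space s
  for s :: "'k::field \<Rightarrow> 'v::ab_group_add \<Rightarrow> 'v" +
  fixes L :: "gen \<Rightarrow> 'v \<Rightarrow> 'v"
  assumes lin: "Vector_Spaces.linear s s (L g)"
    and rel_xy: "L Gx (L Gy v) + L Gy (L Gx v) = s 2 (L Gz v)"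
    and rel_yz: "L Gy (L Gz v) + L Gz (L Gy v) = s 2 (L Gx v)"
    and rel_zx: "L Gz (L Gx v) + L Gx (L Gz v) = s 2 (L Gy v)"
begin

definition ev :: "'k free_alg \<Rightarrow> 'v \<Rightarrow> 'v"
  where "ev p v = (\<Sum>w\<in>Poly_Mapping.keys p. s (Poly_Mapping.lookup p w) (foldr L (letters w) v))"

lemma ev_superset:
  assumes "finite S" "Poly_Mapping.keys p \<subseteq> S"
  shows "ev p v = (\<Sum>w\<in>S. s (Poly_Mapping.lookup p w) (foldr L (letters w) v))"
  unfolding ev_def using assms by (intro sum.mono_neutral_left) (auto simp: in_keys_iff)

lemma ev_zero: "ev 0 v = 0"
  by (simp add: ev_def)

lemma ev_add: "ev (p + q) v = ev p v + ev q v"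
  using keys_add[of p q]
  by (simp add: ev_superset[of "Poly_Mapping.keys p \<union> Poly_Mapping.keys q"] lookup_add
      scale_left_distrib sum.distrib)

lemma ev_minus: "ev (p - q) v = ev p v - ev q v"
  using ev_add[of "p - q" q v] by simp

lemma ev_single: "ev (Poly_Mapping.single w c) v = s c (foldr L (letters w) v)"
  by (simp add: ev_def)

lemma foldr_add: "foldr L ws (v + w) = foldr L ws v + foldr L ws w"
  by (induction ws) (simp_all add: module_hom.add[OF Vector_Spaces.linear.axioms(3)[OF lin]])

lemma foldr_scale: "foldr L ws (s c v) = s c (foldr L ws v)"
  by (induction ws) (simp_all add: module_hom.scale[OF Vector_Spaces.linear.axioms(3)[OF lin]])

lemma foldr_zero: "foldr L ws 0 = 0"
  by (induction ws) (simp_all add: module_hom.zero[OF Vector_Spaces.linear.axioms(3)[OF lin]])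

lemma ev_right_add: "ev p (v + w) = ev p v + ev p w"
  by (simp add: ev_def foldr_add scale_right_distrib sum.distrib)

lemma ev_right_zero: "ev p 0 = 0"
  by (simp add: ev_def foldr_zero)

lemma ev_mult: "ev (p * q) v = ev p (ev q v)"
proof (induction p rule: free_alg_induct)
  case zero
  show ?case by (simp add: ev_zero)
next
  case (add p w c)
  have "ev (Poly_Mapping.single w c * q) v = s c (foldr L (letters w) (ev q v))"
  proof (induction q rule: free_alg_induct)
    case zero
    show ?case by (simp add: ev_zero foldr_zero)
  next
    case (add q w' c')
    then show ?case
      by (simp add: distrib_left ev_add foldr_add scale_right_distrib mult_single ev_single
          plus_word_def foldr_scale)
  qed
  with add show ?case by (simp add: distrib_right ev_add ev_single)
qed

lemma ev_fgen: "ev (fgen g) v = L g v"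
  by (simp add: fgen_def ev_single)

lemma ev_one: "ev 1 v = v"
  using ev_single[of 0 1 v] by (simp add: zero_word_def flip: single_one)

lemma ev_two: "ev 2 v = s 2 v"
  using scale_left_distrib[of 1 1 v] ev_add[of 1 1 v] by (simp add: ev_one)

lemma ev_rel_ideal: "p \<in> rel_ideal \<Longrightarrow> ev p v = 0"
proof (induction p arbitrary: v rule: rel_ideal.induct)
  case (base r)
  then show ?case
    using rel_xy rel_yz rel_zx
    by (auto simp: relators_def ev_minus ev_add ev_mult ev_two ev_fgen)
qed (simp_all add: ev_add ev_mult ev_right_zero)

end

quotient_type (overloaded) 'k asa = "'k::field free_alg" / "\<lambda>p q. p - q \<in> rel_ideal"
proof (rule equivpI)
  show "reflp (\<lambda>p q :: 'k free_alg. p - q \<in> rel_ideal)"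
    by (simp add: reflp_def rel_ideal_zero)
  show "symp (\<lambda>p q :: 'k free_alg. p - q \<in> rel_ideal)"
    using rel_ideal_uminus by (fastforce simp: symp_def)
  show "transp (\<lambda>p q :: 'k free_alg. p - q \<in> rel_ideal)"
    using rel_ideal.add by (fastforce simp: transp_def)
qed

instantiation asa :: (field) ring_1
begin

lift_definition zero_asa :: "'a asa" is 0 .
lift_definition one_asa :: "'a asa" is 1 .
lift_definition plus_asa :: "'a asa \<Rightarrow> 'a asa \<Rightarrow> 'a asa" is "(+)"
  by (metis add_diff_add rel_ideal.add)
lift_definition uminus_asa :: "'a asa \<Rightarrow> 'a asa" is uminus
  by (metis minus_diff_minus rel_ideal_uminus)
lift_definition minus_asa :: "'a asa \<Rightarrow> 'a asa \<Rightarrow> 'a asa" is "(-)"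
proof -
  fix p q r s :: "'a free_alg"
  assume "p - q \<in> rel_ideal" "r - s \<in> rel_ideal"
  then have "(p - q) + - (r - s) \<in> rel_ideal"
    by (intro rel_ideal.add rel_ideal_uminus)
  then show "p - r - (q - s) \<in> rel_ideal" by (simp add: algebra_simps)
qed
lift_definition times_asa :: "'a asa \<Rightarrow> 'a asa \<Rightarrow> 'a asa" is "(*)"
proof -
  fix p q r s :: "'a free_alg"
  assume "p - q \<in> rel_ideal" "r - s \<in> rel_ideal"
  then have "(p - q) * r + q * (r - s) \<in> rel_ideal"
    by (intro rel_ideal.add rel_ideal.lmult rel_ideal.rmult)
  then show "p * r - q * s \<in> rel_ideal" by (simp add: algebra_simps)
qed

instance
proof
  show "(0::'a asa) \<noteq> 1"
  proof transfer
    interpret gen_maps "(*) :: 'a \<Rightarrow> 'a \<Rightarrow> 'a" "\<lambda>_ _. 0"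
      by unfold_locales (simp_all add: algebra_simps)
    show "(0::'a free_alg) - 1 \<notin> rel_ideal"
      using ev_rel_ideal[of "0 - 1" 1] ev_minus[of 0 1 1] by (auto simp: ev_zero ev_one)
  qed
qed (transfer; simp add: algebra_simps rel_ideal_zero)+

end

lift_definition scalar :: "'k::field \<Rightarrow> 'k asa" is "Poly_Mapping.single 0" .

lift_definition gen :: "gen \<Rightarrow> 'k::field asa" is fgen .

lemma asa_relations:
  "gen Gx * gen Gy + gen Gy * gen Gx = (2 * gen Gz :: 'k::field asa)"
  "gen Gy * gen Gz + gen Gz * gen Gy = (2 * gen Gx :: 'k::field asa)"
  "gen Gz * gen Gx + gen Gx * gen Gz = (2 * gen Gy :: 'k::field asa)"
proof -
  have two: "(2 :: 'k asa) * u = u + u" for u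
    by (rule mult_2)
  show "gen Gx * gen Gy + gen Gy * gen Gx = (2 * gen Gz :: 'k asa)"
    "gen Gy * gen Gz + gen Gz * gen Gy = (2 * gen Gx :: 'k asa)"
    "gen Gz * gen Gx + gen Gx * gen Gz = (2 * gen Gy :: 'k asa)"
    unfolding two
    by (transfer, rule rel_ideal.base, simp add: relators_def mult_2)+
qed

lemma scalar_ring_hom:
  "scalar (a + b) = scalar a + scalar b" "scalar (a * b) = scalar a * scalar b" "scalar 1 = 1"
  by (transfer; simp add: single_add mult_single rel_ideal_zero)+

lemma scalar_central: "scalar c * u = u * scalar c"
proof transfer
  fix c :: 'a and u :: "'a free_alg"
  have "Poly_Mapping.single 0 c * u = u * Poly_Mapping.single 0 c"
    by (induction u rule: free_alg_induct)
      (simp_all add: algebra_simps mult_single)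
  then show "Poly_Mapping.single 0 c * u - u * Poly_Mapping.single 0 c \<in> rel_ideal"
    by (simp add: rel_ideal_zero)
qed

locale asa_module =
  fixes act :: "'k::field asa \<Rightarrow> 'v::ab_group_add \<Rightarrow> 'v"
  assumes act_add_right: "act r (v + w) = act r v + act r w"
    and act_add_left: "act (r + s) v = act r v + act s v"
    and act_mult: "act (r * s) v = act r (act s v)"
    and act_one: "act 1 v = v"
begin

definition scale :: "'k \<Rightarrow> 'v \<Rightarrow> 'v"
  where "scale c v = act (scalar c) v"

sublocale vector_space scale
  by unfold_locales
    (simp_all add: scale_def act_add_right act_add_left scalar_ring_hom act_one flip: act_mult)

lemma linear_act: "Vector_Spaces.linear scale scale (act r)"
  by unfold_locales
    (simp_all add: act_add_right scale_def scalar_central flip: act_mult)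

definition irreducible :: bool
  where "irreducible \<longleftrightarrow> (UNIV :: 'v set) \<noteq> {0} \<and>
    (\<forall>W. subspace W \<and> (\<forall>r. act r ` W \<subseteq> W) \<longrightarrow> W = {0} \<or> W = UNIV)"

definition finite_dimensional :: bool
  where "finite_dimensional \<longleftrightarrow> (\<exists>S. finite S \<and> span S = UNIV)"

definition is_basis :: "nat \<Rightarrow> (nat \<Rightarrow> 'v) \<Rightarrow> bool"
  where "is_basis d u \<longleftrightarrow> inj_on u {0..d} \<and> independent (u ` {0..d}) \<and> span (u ` {0..d}) = UNIV"

definition represents :: "nat \<Rightarrow> (nat \<Rightarrow> nat \<Rightarrow> 'k) \<Rightarrow> ('v \<Rightarrow> 'v) \<Rightarrow> (nat \<Rightarrow> 'v) \<Rightarrow> bool"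
  where "represents d B T u \<longleftrightarrow> (\<forall>j\<le>d. T (u j) = (\<Sum>i=0..d. scale (B i j) (u i)))"

text \<open>Being isomorphic to the module given by the formulas below on a basis
  \<open>v\<^sub>0, \<dots>, v\<^sub>d\<close> means having such a basis.
  The case distinctions implement \<open>v\<^bsub>-1\<^esub> = 0 = v\<^bsub>d+1\<^esub>\<close>; for \<open>i = 0\<close> the truncated
  exponent \<open>i - 1\<close> only occurs next to \<open>v\<^bsub>-1\<^esub>\<close>.\<close>

definition type_B :: "nat \<Rightarrow> bool"
  where "type_B d \<longleftrightarrow> even d \<and> (\<exists>v. is_basis d v \<and>
    (let lo = (\<lambda>i. if i = 0 then 0 else v (i - 1));
         hi = (\<lambda>i. if i = d then 0 else v (i + 1))
     in \<forall>i\<le>d.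
       act (gen Gx) (v i) = scale ((-1) ^ i * (of_nat d - 2 * of_nat i)) (v i) \<and>
       act (gen Gy) (v i) =
         scale (of_nat d - of_nat i + 1) (lo i) + scale (of_nat i + 1) (hi i) \<and>
       act (gen Gz) (v i) =
         scale ((-1) ^ (i - 1) * (of_nat d - of_nat i + 1)) (lo i)
         + scale ((-1) ^ i * (of_nat i + 1)) (hi i)))"

definition theta :: "nat \<Rightarrow> nat \<Rightarrow> 'k"
  where "theta d i = (-1) ^ i * (of_nat d - 2 * of_nat i)"

definition eigenspace :: "gen \<Rightarrow> 'k \<Rightarrow> 'v set"
  where "eigenspace a \<mu> = {v. act (gen a) v = scale \<mu> v}"

text \<open>The description determines the map uniquely when \<open>gen a\<close> acts diagonalizably, as it does
  on modules of type \<open>B(d)\<close>.\<close>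

definition prim_idem :: "nat \<Rightarrow> gen \<Rightarrow> nat \<Rightarrow> 'v \<Rightarrow> 'v"
  where "prim_idem d a i = (THE E. Vector_Spaces.linear scale scale E \<and>
    (\<forall>v\<in>eigenspace a (theta d i). E v = v) \<and>
    (\<forall>\<mu>. \<mu> \<noteq> theta d i \<longrightarrow> (\<forall>v\<in>eigenspace a \<mu>. E v = 0)))"

end

text \<open>Universal property of the presentation: operators satisfying the three relations extend to a
  module structure.\<close>

lemma asa_module_exists:
  assumes "gen_maps s L"
  shows "\<exists>act. asa_module act \<and> asa_module.scale act = s \<and> (\<forall>g. act (gen g) = L g)"
proof -
  interpret gen_maps s L by fact
  define act where "act = (\<lambda>r v. ev (rep_asa r) v)"
  have act_abs: "act (abs_asa p) v = ev p v" for p v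
  proof -
    have "rep_asa (abs_asa p) - p \<in> rel_ideal"
      by (rule rep_abs_rsp_left[OF Quotient3_asa]) (simp add: rel_ideal_zero)
    then show ?thesis
      using ev_rel_ideal[of "rep_asa (abs_asa p) - p" v] by (simp add: act_def ev_minus)
  qed
  have m: "asa_module act"
  proof
    fix r t :: "'a asa" and v w :: 'b
    show "act r (v + w) = act r v + act r w" by (simp add: act_def ev_right_add)
    obtain p q where "r = abs_asa p" "t = abs_asa q"
      using Quotient_abs_rep[OF Quotient_asa] by metis
    then show "act (r + t) v = act r v + act t v" "act (r * t) v = act r (act t v)"
      by (simp_all add: plus_asa.abs_eq times_asa.abs_eq act_abs ev_add ev_mult)
    show "act 1 v = v" by (simp add: one_asa.abs_eq act_abs ev_one)
  qed
  have "asa_module.scale act c v = s c v" for c v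
    by (simp add: asa_module.scale_def[OF m] scalar.abs_eq act_abs ev_single zero_word_def)
  then have "asa_module.scale act = s" by (intro ext)
  moreover have "act (gen g) = L g" for g
    by (intro ext) (simp add: gen.abs_eq act_abs ev_fgen)
  ultimately show ?thesis using m by blast
qed

end

theory Submission
  imports Defs
begin

text \<open>Call a basis \<open>v\<^sub>0, \<dots>, v\<^sub>d\<close> standard for \<open>(a, b, c)\<close> if \<open>a, b, c\<close> act on it as \<open>x, y, z\<close> act in
  the definition of type \<open>B(d)\<close>. The sum of a standard basis for \<open>(a, b, c)\<close> is an eigenvector of
  \<open>b\<close> for \<open>\<theta>\<^sub>0 = d\<close>; as this eigenspace is a line, every basis \<open>e\<^sub>i\<^sup>a v\<^sup>b\<close> is a scalar multiple of the
  standard basis. So it suffices that standard bases exist for every permutation of \<open>(x, y, z)\<close>.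
  Exchanging \<open>b\<close> and \<open>c\<close> only takes sign changes. To exchange \<open>a\<close> and \<open>b\<close>, start from the eigenvector
  of \<open>b\<close> above and apply \<open>a \<plusminus> c\<close> repeatedly: these operators permute the eigenspaces of \<open>b\<close>, and
  \<open>(a \<plusminus> c)\<^sup>2 = (a\<^sup>2 + b\<^sup>2 + c\<^sup>2) - b\<^sup>2 \<plusminus> 2 b\<close>, where the Casimir element \<open>a\<^sup>2 + b\<^sup>2 + c\<^sup>2\<close> acts as
  \<open>d(d + 2)\<close>.\<close>

locale asa_module_char_0 = asa_module act
  for act :: "'k::field_char_0 asa \<Rightarrow> 'v::ab_group_add \<Rightarrow> 'v"
begin

section \<open>Linearity of the action and the relations on vectors\<close>

lemma act_scale: "act r (scale k v) = scale k (act r v)"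
  by (rule module_hom.scale[OF Vector_Spaces.linear.axioms(3)[OF linear_act]])

lemma act_zero: "act r 0 = 0"
  by (rule module_hom.zero[OF Vector_Spaces.linear.axioms(3)[OF linear_act]])

lemma act_sum: "act r (sum f S) = (\<Sum>i\<in>S. act r (f i))"
  by (rule module_hom.sum[OF Vector_Spaces.linear.axioms(3)[OF linear_act]])

text \<open>The left sides of the relations are symmetric, so permuting the generators only permutes
  the relations. This lets all later arguments run for an arbitrary ordering
  \<open>(a, b, c)\<close>.\<close>

lemma act_anticommute:
  assumes "a \<noteq> b" "c \<noteq> a" "c \<noteq> b"
  shows "act (gen a) (act (gen b) u) + act (gen b) (act (gen a) u) = scale 2 (act (gen c) u)"
proof -
  have "scale 2 u = act 2 u" for u
    using scale_left_distrib[of 1 1 u] act_add_left[of 1 1 u] by (simp add: act_one)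
  then have eq: "act (r * s) u + act (s * r) u = scale 2 (act t u)" if "r * s + s * r = 2 * t" for r s t
    using arg_cong[OF that, of "\<lambda>r. act r u"] by (simp add: act_add_left act_mult)
  have "gen a * gen b + gen b * gen a = (2 * gen c :: 'k asa)"
    using assms asa_relations[where 'k='k]
    by (cases a; cases b; cases c; simp add: add.commute)
  from eq[OF this] show ?thesis by (simp add: act_mult)
qed

section \<open>Coordinates and bases indexed by 0, ..., d\<close>

lemma is_basis_coords:
  assumes "is_basis d v"
  obtains k where "u = (\<Sum>i=0..d. scale (k i) (v i))"
proof -
  have "u \<in> span (v ` {0..d})" using assms by (simp add: is_basis_def)
  then obtain f where "u = (\<Sum>x\<in>v ` {0..d}. scale (f x) x)"
    by (auto simp: span_finite)
  also have "\<dots> = (\<Sum>i=0..d. scale (f (v i)) (v i))"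
    using assms by (subst sum.reindex) (auto simp: is_basis_def)
  finally show ?thesis by (rule that)
qed

lemma is_basis_independent:
  assumes "is_basis d v" "(\<Sum>i=0..d. scale (k i) (v i)) = 0" "i \<le> d"
  shows "k i = 0"
proof -
  have inj: "inj_on v {0..d}" and ind: "independent (v ` {0..d})"
    using assms by (auto simp: is_basis_def)
  let ?f = "\<lambda>x. k (the_inv_into {0..d} v x)"
  have "(\<Sum>x\<in>v ` {0..d}. scale (?f x) x) = (\<Sum>i=0..d. scale (k i) (v i))"
    using inj by (subst sum.reindex) (auto simp: the_inv_into_f_f intro!: sum.cong)
  then have "?f (v i) = 0"
    using independentD[OF ind, of "v ` {0..d}" ?f "v i"] assms by auto
  then show ?thesis using inj assms by (simp add: the_inv_into_f_f)
qed

text \<open>The basis \<open>v\<close> fixes the dimension as d + 1, so independence of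
  \<open>w\<close> suffices. Coefficients belong to indices, so the hypothesis also excludes
  repetitions in \<open>w\<close>.\<close>

lemma is_basisI:
  assumes v: "is_basis d v"
    and ind: "\<And>k i. (\<Sum>i=0..d. scale (k i) (w i)) = 0 \<Longrightarrow> i \<le> d \<Longrightarrow> k i = 0"
  shows "is_basis d w"
proof -
  have inj: "inj_on w {0..d}"
  proof (rule inj_onI, rule ccontr)
    fix i j assume ij: "i \<in> {0..d}" "j \<in> {0..d}" "w i = w j" "i \<noteq> j"
    let ?k = "\<lambda>l. (if l = i then 1 else 0) - (if l = j then 1 else 0)"
    have "(\<Sum>l=0..d. scale (?k l) (w l)) =
      (\<Sum>l=0..d. (if l = i then w l else 0) - (if l = j then w l else 0))"
      by (intro sum.cong) (auto simp: scale_left_diff_distrib)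
    also have "\<dots> = 0"
      using ij by (simp add: sum_subtractf)
    finally show False using ind[of ?k i] ij by auto
  qed
  have indep: "independent (w ` {0..d})"
  proof
    assume "dependent (w ` {0..d})"
    then obtain f i where f: "(\<Sum>x\<in>w ` {0..d}. scale (f x) x) = 0" "i \<le> d" "f (w i) \<noteq> 0"
      by (auto simp: dependent_finite)
    have "(\<Sum>i=0..d. scale (f (w i)) (w i)) = 0"
      using f(1) inj by (subst (asm) sum.reindex) auto
    from ind[OF this f(2)] f(3) show False by simp
  qed
  have "u \<in> span (w ` {0..d})" for u
  proof (rule ccontr)
    assume u: "u \<notin> span (w ` {0..d})"
    then have "independent (insert u (w ` {0..d}))"
      using indep by (simp add: independent_insert)
    \<comment> \<open>Otherwise d + 2 independent vectors would lie in the span of the d + 1 vectors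
      \<open>v i\<close>.\<close>
    then have "card (insert u (w ` {0..d})) \<le> card (v ` {0..d})"
      using v by (intro independent_span_bound[THEN conjunct2]) (auto simp: is_basis_def)
    moreover have "u \<notin> w ` {0..d}" using u span_base by blast
    ultimately show False
      using inj v by (simp add: card_image is_basis_def)
  qed
  with inj indep show ?thesis by (auto simp: is_basis_def)
qed

lemma is_basis_scale:
  assumes "is_basis d v" "\<And>i. i \<le> d \<Longrightarrow> k i \<noteq> 0"
  shows "is_basis d (\<lambda>i. scale (k i) (v i))"
  using assms(1)
proof (rule is_basisI)
  fix l i assume "(\<Sum>i=0..d. scale (l i) (scale (k i) (v i))) = 0" "i \<le> d"
  then show "l i = 0"
    using is_basis_independent[OF assms(1), of "\<lambda>i. l i * k i" i] assms(2)[of i] by simp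
qed

lemma is_basis_nonzero:
  assumes "is_basis d v" "i \<le> d"
  shows "v i \<noteq> 0"
  using assms dependent_zero by (fastforce simp: is_basis_def)

section \<open>Eigenvalues and eigenbases\<close>

lemma theta_inj:
  assumes "even d"
  shows "inj (theta d)"
proof (rule injI)
  fix i j assume eq: "theta d i = theta d j"
  \<comment> \<open>With equal signs the indices agree. Opposite signs would give i + j = d with i +
    j odd, which the evenness of \<open>d\<close> excludes.\<close>
  have "(-1) ^ i = (-1 :: 'k) ^ j \<and> int d - 2 * int i = int d - 2 * int j
    \<or> odd (i + j) \<and> int d - 2 * int i = - (int d - 2 * int j)"
  proof (cases "even (i + j)")
    case True
    then have "(-1) ^ i = (-1 :: 'k) ^ j" by (auto simp: minus_one_power_iff)
    moreover from this eq have "of_int (int d - 2 * int i) = (of_int (int d - 2 * int j) :: 'k)"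
      by (simp add: theta_def)
    ultimately show ?thesis unfolding of_int_eq_iff by blast
  next
    case False
    with eq have "of_int (int d - 2 * int i) = (of_int (- (int d - 2 * int j)) :: 'k)"
      by (cases "even i"; cases "even j"; simp add: theta_def algebra_simps)
    then have "int d - 2 * int i = - (int d - 2 * int j)" unfolding of_int_eq_iff .
    with False show ?thesis by blast
  qed
  then show "i = j"
  proof
    assume "odd (i + j) \<and> int d - 2 * int i = - (int d - 2 * int j)"
    then have "odd (i + j)" "i + j = d" by linarith+
    with assms show ?thesis by simp
  qed simp
qed

text \<open>This is the shift \<open>2 * \<epsilon> - \<theta>\<close> of
  \<open>ladder_eigenvector\<close> for the sign \<open>(-1) ^ i\<close>: one ladder step leads from
  index \<open>i\<close> to \<open>Suc i\<close>.\<close>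

lemma theta_Suc: "theta d (Suc i) = 2 * (-1) ^ i - theta d i"
  by (simp add: theta_def algebra_simps)

lemma eigenvectors_sum_zero:
  assumes "finite S" "inj_on \<mu> S" "\<And>i. i \<in> S \<Longrightarrow> act r (w i) = scale (\<mu> i) (w i)"
    and "sum w S = 0" "i \<in> S"
  shows "w i = 0"
  using assms
proof (induction S arbitrary: w i rule: finite_induct)
  case (insert j S)
  have other: "w i = 0" if "i \<in> S" for i
  proof -
    \<comment> \<open>Acting by \<open>r\<close> minus \<open>\<mu> j\<close> kills
      \<open>w j\<close> and multiplies every other \<open>w i\<close> by a nonzero scalar, so the
      induction hypothesis applies to the rescaled vectors.\<close>
    have "act r (sum w (insert j S)) - scale (\<mu> j) (sum w (insert j S)) =
      (\<Sum>i\<in>insert j S. scale (\<mu> i - \<mu> j) (w i))"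
      using insert.prems(2)
      by (simp add: act_sum scale_sum_right scale_left_diff_distrib flip: sum_subtractf)
    then have "(\<Sum>i\<in>S. scale (\<mu> i - \<mu> j) (w i)) = 0"
      using insert.hyps unfolding insert.prems(3) by (simp add: act_zero)
    then have "scale (\<mu> i - \<mu> j) (w i) = 0"
      using insert.prems that
      by (intro insert.IH[where w="\<lambda>i. scale (\<mu> i - \<mu> j) (w i)"])
        (auto simp: act_scale mult.commute)
    moreover have "\<mu> i \<noteq> \<mu> j" using insert.prems(1) insert.hyps that by (auto simp: inj_on_def)
    ultimately show ?thesis by simp
  qed
  moreover have "w j = 0"
    using insert.prems(3) insert.hyps other by simp
  ultimately show ?case using insert.prems by auto
qed simp

definition eigenbasis :: "nat \<Rightarrow> gen \<Rightarrow> (nat \<Rightarrow> 'v) \<Rightarrow> bool"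
  where "eigenbasis d g w \<longleftrightarrow> even d \<and> is_basis d w \<and>
    (\<forall>i\<le>d. act (gen g) (w i) = scale (theta d i) (w i))"

lemma eigenbasisI:
  assumes "even d" "is_basis d v" "\<And>i. i \<le> d \<Longrightarrow> w i \<noteq> 0"
    and eig: "\<And>i. i \<le> d \<Longrightarrow> act (gen g) (w i) = scale (theta d i) (w i)"
  shows "eigenbasis d g w"
proof -
  have "is_basis d w" using assms(2)
  proof (rule is_basisI)
    fix k i assume k: "(\<Sum>i=0..d. scale (k i) (w i)) = 0" "i \<le> d"
    have "scale (k i) (w i) = 0"
      using k theta_inj[OF assms(1)] eig
      by (intro eigenvectors_sum_zero[where S="{0..d}" and \<mu>="theta d" and r="gen g"
            and w="\<lambda>i. scale (k i) (w i)"])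
        (auto simp: act_scale mult.commute inj_on_def)
    with assms(3)[OF k(2)] show "k i = 0" by simp
  qed
  with assms show ?thesis by (simp add: eigenbasis_def)
qed

text \<open>Acting by \<open>g\<close> minus \<open>\<mu>\<close> kills \<open>u\<close> and
  multiplies its coordinate \<open>k i\<close> by \<open>theta d i - \<mu>\<close>. Hence
  \<open>u\<close> vanishes if \<open>\<mu>\<close> is no \<open>theta d i\<close> with i at most d,
  and lies on one line otherwise.\<close>

lemma eigenbasis_coords:
  assumes w: "eigenbasis d g w" and u: "act (gen g) u = scale \<mu> u"
    and eq: "u = (\<Sum>i=0..d. scale (k i) (w i))"
  shows "\<forall>i\<le>d. \<mu> \<noteq> theta d i \<longrightarrow> k i = 0"
proof (intro allI impI)
  fix i assume i: "i \<le> d" "\<mu> \<noteq> theta d i"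
  have "0 = act (gen g) u - scale \<mu> u" using u by simp
  also have "\<dots> = (\<Sum>i=0..d. scale ((theta d i - \<mu>) * k i) (w i))"
    using w unfolding eq
    by (simp add: act_sum act_scale scale_sum_right eigenbasis_def algebra_simps flip: sum_subtractf)
  finally have "(theta d i - \<mu>) * k i = 0"
    using w i is_basis_independent[of d w "\<lambda>i. (theta d i - \<mu>) * k i" i]
    by (simp add: eigenbasis_def)
  with i show "k i = 0" by simp
qed

lemma eigenvector_zero:
  assumes "eigenbasis d g w" "act (gen g) u = scale \<mu> u" "\<And>i. i \<le> d \<Longrightarrow> \<mu> \<noteq> theta d i"
  shows "u = 0"
proof -
  have "is_basis d w" using assms by (simp add: eigenbasis_def)
  then obtain k where k: "u = (\<Sum>i=0..d. scale (k i) (w i))" by (rule is_basis_coords)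
  from eigenbasis_coords[OF assms(1,2) k] assms(3) show ?thesis by (simp add: k)
qed

lemma eigenvector_line:
  assumes "eigenbasis d g w" "act (gen g) u = scale (theta d i) u" "i \<le> d"
  obtains l where "u = scale l (w i)"
proof -
  have "is_basis d w" using assms by (simp add: eigenbasis_def)
  then obtain k where k: "u = (\<Sum>j=0..d. scale (k j) (w j))" by (rule is_basis_coords)
  have "inj (theta d)" using assms by (intro theta_inj) (simp add: eigenbasis_def)
  then have "\<forall>j\<le>d. j \<noteq> i \<longrightarrow> k j = 0"
    using eigenbasis_coords[OF assms(1,2) k] by (auto simp: inj_def)
  then have "u = (\<Sum>j=0..d. if j = i then scale (k i) (w i) else 0)"
    unfolding k by (intro sum.cong) auto
  with assms(3) show ?thesis by (intro that[of "k i"]) simp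
qed

section \<open>Primitive idempotents on an eigenbasis\<close>

lemma prim_idem_eigenbasis:
  assumes w: "eigenbasis d g w" and i: "i \<le> d"
  shows "Vector_Spaces.linear scale scale (prim_idem d g i)"
    and "\<And>j. j \<le> d \<Longrightarrow> prim_idem d g i (w j) = (if j = i then w i else 0)"
proof -
  interpret vector_space_pair scale scale ..
  let ?P = "\<lambda>E. Vector_Spaces.linear scale scale E \<and>
    (\<forall>v\<in>eigenspace g (theta d i). E v = v) \<and>
    (\<forall>\<mu>. \<mu> \<noteq> theta d i \<longrightarrow> (\<forall>v\<in>eigenspace g \<mu>. E v = 0))"
  have inj: "inj (theta d)" using w by (intro theta_inj) (simp add: eigenbasis_def)
  have basis: "is_basis d w" and eig: "\<And>j. j \<le> d \<Longrightarrow> act (gen g) (w j) = scale (theta d j) (w j)"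
    using w by (auto simp: eigenbasis_def)
  \<comment> \<open>The defining conditions force the values on \<open>w\<close>, which yields
    uniqueness as well as the second claim.\<close>
  have val: "E (w j) = (if j = i then w i else 0)" if "?P E" "j \<le> d" for E j
  proof (cases "j = i")
    case True
    with that eig show ?thesis by (auto simp: eigenspace_def)
  next
    case False
    then have "theta d j \<noteq> theta d i" using inj by (auto simp: inj_def)
    then show ?thesis using that eig[of j] False by (auto simp: eigenspace_def)
  qed
  have "independent (w ` {0..d})" using basis by (simp add: is_basis_def)
  \<comment> \<open>Existence: the extension needs a function of vectors, so the test compares
    \<open>w j\<close> with \<open>w i\<close>; by injectivity of \<open>w\<close> this amounts to
    comparing indices.\<close>
  from linear_independent_extend[OF this, of "\<lambda>x. if x = w i then w i else 0"]
  obtain E where E: "Vector_Spaces.linear scale scale E"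
    and E_w: "\<And>j. j \<le> d \<Longrightarrow> E (w j) = (if w j = w i then w i else 0)" by auto
  have "?P E"
  proof (intro conjI ballI allI impI E)
    fix v assume "v \<in> eigenspace g (theta d i)"
    then obtain l where "v = scale l (w i)"
      using eigenvector_line[OF w _ i, of v] by (auto simp: eigenspace_def)
    then show "E v = v" using E_w[OF i] by (simp add: linear_scale[OF E])
  next
    fix \<mu> v assume \<mu>: "\<mu> \<noteq> theta d i" and v: "v \<in> eigenspace g \<mu>"
    show "E v = 0"
    proof (cases "\<exists>j\<le>d. \<mu> = theta d j")
      case True
      then obtain j where j: "j \<le> d" "\<mu> = theta d j" by blast
      then obtain l where l: "v = scale l (w j)"
        using eigenvector_line[OF w _ j(1), of v] v by (auto simp: eigenspace_def)
      have "w j \<noteq> w i"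
        using basis i j \<mu> inj_onD[of w "{0..d}" j i] by (auto simp: is_basis_def)
      then show ?thesis using E_w[OF j(1)] l by (simp add: linear_scale[OF E])
    next
      case False
      then have "v = 0" using eigenvector_zero[OF w, of v \<mu>] v by (auto simp: eigenspace_def)
      then show ?thesis by (simp add: linear_0[OF E])
    qed
  qed
  moreover have "E' = E" if "?P E'" for E'
  proof
    fix u
    obtain k where u: "u = (\<Sum>i=0..d. scale (k i) (w i))" using basis by (rule is_basis_coords)
    have E': "Vector_Spaces.linear scale scale E'" using that by blast
    show "E' u = E u"
      unfolding u linear_sum[OF E] linear_sum[OF E'] linear_scale[OF E] linear_scale[OF E']
      using val[OF that] val[OF \<open>?P E\<close>] by (intro sum.cong) auto
  qed
  ultimately have P: "?P (prim_idem d g i)"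
    unfolding prim_idem_def by (rule theI)
  then show "Vector_Spaces.linear scale scale (prim_idem d g i)" by blast
  show "prim_idem d g i (w j) = (if j = i then w i else 0)" if "j \<le> d" for j
    using val[OF P that] .
qed

section \<open>Standard bases\<close>

definition lower :: "(nat \<Rightarrow> 'v) \<Rightarrow> nat \<Rightarrow> 'v"
  where "lower v i = (if i = 0 then 0 else v (i - 1))"

definition upper :: "nat \<Rightarrow> (nat \<Rightarrow> 'v) \<Rightarrow> nat \<Rightarrow> 'v"
  where "upper d v i = (if i = d then 0 else v (i + 1))"

text \<open>Taking out \<open>(-1) ^ i\<close> in the third formula avoids the truncated exponent
  \<open>i - 1\<close> and shows \<open>b\<close> and \<open>c\<close> as the sum and the signed
  difference of the same two terms.\<close>

definition standard_basis :: "nat \<Rightarrow> gen \<Rightarrow> gen \<Rightarrow> gen \<Rightarrow> (nat \<Rightarrow> 'v) \<Rightarrow> bool"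
  where "standard_basis d a b c v \<longleftrightarrow> even d \<and> is_basis d v \<and> (\<forall>i\<le>d.
    act (gen a) (v i) = scale (theta d i) (v i) \<and>
    act (gen b) (v i) =
      scale (of_nat d - of_nat i + 1) (lower v i) + scale (of_nat i + 1) (upper d v i) \<and>
    act (gen c) (v i) =
      scale ((-1) ^ i) (scale (of_nat i + 1) (upper d v i)
        - scale (of_nat d - of_nat i + 1) (lower v i)))"

lemma standard_basis_eigenbasis: "standard_basis d a b c v \<Longrightarrow> eigenbasis d a v"
  by (simp add: standard_basis_def eigenbasis_def)

lemma type_B_standard_basis:
  assumes "type_B d"
  shows "\<exists>v. standard_basis d Gx Gy Gz v"
proof -
  from assms obtain v where v: "even d" "is_basis d v"
    and act: "\<And>i. i \<le> d \<Longrightarrow> act (gen Gx) (v i) = scale (theta d i) (v i) \<and>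
       act (gen Gy) (v i) =
         scale (of_nat d - of_nat i + 1) (lower v i) + scale (of_nat i + 1) (upper d v i) \<and>
       act (gen Gz) (v i) =
         scale ((-1) ^ (i - 1) * (of_nat d - of_nat i + 1)) (lower v i)
         + scale ((-1) ^ i * (of_nat i + 1)) (upper d v i)"
    unfolding type_B_def Let_def theta_def lower_def upper_def by blast
  have "scale ((-1) ^ (i - 1) * (of_nat d - of_nat i + 1)) (lower v i)
         + scale ((-1) ^ i * (of_nat i + 1)) (upper d v i) =
      scale ((-1) ^ i) (scale (of_nat i + 1) (upper d v i)
        - scale (of_nat d - of_nat i + 1) (lower v i))" for i
    by (cases i) (simp_all add: lower_def scale_right_diff_distrib)
  with v act show ?thesis by (auto simp: standard_basis_def)
qed

section \<open>Ladder operators and the Casimir element\<close>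

definition ladder :: "gen \<Rightarrow> gen \<Rightarrow> 'k \<Rightarrow> 'v \<Rightarrow> 'v"
  where "ladder a c \<epsilon> u = act (gen a) u + scale \<epsilon> (act (gen c) u)"

lemma ladder_scale: "ladder a c \<epsilon> (scale k u) = scale k (ladder a c \<epsilon> u)"
  by (simp add: ladder_def act_scale scale_right_distrib mult.commute)

lemma ladder_zero: "ladder a c \<epsilon> 0 = 0"
  by (simp add: ladder_def act_zero)

lemma sign_cases: "(-1) ^ i = (1 :: 'k) \<or> (-1) ^ i = (-1 :: 'k)"
  by (cases "even i") auto

text \<open>By ba + ab = 2c, bc + cb = 2a and \<epsilon>^2 = 1, the element t = a + \<epsilon>c
  satisfies bt + tb = 2\<epsilon>t.\<close>

lemma ladder_eigenvector:
  assumes "a \<noteq> b" "c \<noteq> a" "c \<noteq> b"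
    and "act (gen b) u = scale \<theta> u" "\<epsilon> = 1 \<or> \<epsilon> = -1"
  shows "act (gen b) (ladder a c \<epsilon> u) = scale (2 * \<epsilon> - \<theta>) (ladder a c \<epsilon> u)"
proof -
  have "act (gen b) (act (gen a) u) = scale 2 (act (gen c) u) - scale \<theta> (act (gen a) u)"
    using act_anticommute[of a b c u] assms by (simp add: act_scale eq_diff_eq add.commute)
  moreover have "act (gen b) (act (gen c) u) = scale 2 (act (gen a) u) - scale \<theta> (act (gen c) u)"
    using act_anticommute[of b c a u] assms by (simp add: act_scale eq_diff_eq)
  ultimately show ?thesis
    using assms(5) by (auto simp: ladder_def act_add_right act_scale algebra_simps)
qed

text \<open>The cross terms form the anticommutator ac + ca = 2b. Once the Casimir element is a
  scalar, the square therefore depends on \<open>b\<close> alone.\<close>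

lemma ladder_square:
  assumes "a \<noteq> b" "c \<noteq> a" "c \<noteq> b" "\<epsilon> = 1 \<or> \<epsilon> = -1"
  shows "ladder a c \<epsilon> (ladder a c \<epsilon> u) = act (gen a) (act (gen a) u)
    + act (gen c) (act (gen c) u) + scale (2 * \<epsilon>) (act (gen b) u)"
proof -
  have "ladder a c \<epsilon> (ladder a c \<epsilon> u) = act (gen a) (act (gen a) u) + act (gen c) (act (gen c) u)
      + scale \<epsilon> (act (gen a) (act (gen c) u) + act (gen c) (act (gen a) u))"
    using assms(4) by (auto simp: ladder_def act_add_right act_scale algebra_simps)
  also have "act (gen a) (act (gen c) u) + act (gen c) (act (gen a) u) = scale 2 (act (gen b) u)"
    using assms by (intro act_anticommute) auto
  finally show ?thesis by (simp add: mult.commute)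
qed

text \<open>The sign \<open>(-1) ^ i\<close> makes the lower terms of \<open>b\<close> and
  \<open>c\<close> cancel and the upper ones double.\<close>

lemma standard_basis_up:
  assumes "standard_basis d a b c v" "i \<le> d"
  shows "ladder b c ((-1) ^ i) (v i) = scale (2 * (of_nat i + 1)) (upper d v i)"
proof -
  have two: "scale (2 * k) u = scale k u + scale k u" for k u
    by (simp only: mult_2 scale_left_distrib)
  show ?thesis
    using assms sign_cases[of i] unfolding two by (auto simp: standard_basis_def ladder_def)
qed

text \<open>On \<open>v (Suc i)\<close> the sign in \<open>c\<close> is opposite, so the operator
  that raises \<open>v i\<close> now cancels the upper terms and leads back.\<close>

lemma standard_basis_down:
  assumes "standard_basis d a b c v" "i < d"
  shows "ladder b c ((-1) ^ i) (v (Suc i)) = scale (2 * (of_nat d - of_nat i)) (v i)"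
proof -
  have two: "scale (2 * k) u = scale k u + scale k u" for k u
    by (simp only: mult_2 scale_left_distrib)
  show ?thesis
    using assms sign_cases[of i] unfolding two
    by (auto simp: standard_basis_def ladder_def lower_def Suc_le_eq)
qed

text \<open>The actions of \<open>b\<close> and \<open>c\<close> are recovered from their two signed
  combinations by adding and subtracting, as 2 is invertible.\<close>

lemma standard_basisI:
  assumes v: "even d" "is_basis d v" "\<And>i. i \<le> d \<Longrightarrow> act (gen a) (v i) = scale (theta d i) (v i)"
    and up: "\<And>i. i \<le> d \<Longrightarrow>
      ladder b c ((-1) ^ i) (v i) = scale (2 * (of_nat i + 1)) (upper d v i)"
    and down: "\<And>i. i \<le> d \<Longrightarrow>
      ladder b c (- ((-1) ^ i)) (v i) = scale (2 * (of_nat d - of_nat i + 1)) (lower v i)"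
  shows "standard_basis d a b c v"
proof -
  have half: "P = t + s \<and> Q = scale \<epsilon> (s - t)"
    if "P + scale \<epsilon> Q = scale 2 s" "P + scale (- \<epsilon>) Q = scale 2 t" "\<epsilon> = 1 \<or> \<epsilon> = -1"
    for P Q s t and \<epsilon> :: 'k
  proof -
    have two: "scale 2 u = u + u" for u
      using scale_left_distrib[of 1 1 u] by simp
    have "scale 2 P = scale 2 (t + s)"
      unfolding two[of P] scale_right_distrib that(1,2)[symmetric] by (simp add: algebra_simps)
    then have P: "P = t + s" by (simp del: scale_right_distrib)
    then have "scale \<epsilon> Q = s - t"
      using that(1) by (simp add: two algebra_simps)
    \<comment> \<open>The sign is its own inverse, so a second multiplication isolates
      \<open>Q\<close>.\<close>
    then have "scale \<epsilon> (scale \<epsilon> Q) = scale \<epsilon> (s - t)" by simp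
    with P that(3) show ?thesis by auto
  qed
  have "act (gen b) (v i) =
      scale (of_nat d - of_nat i + 1) (lower v i) + scale (of_nat i + 1) (upper d v i) \<and>
    act (gen c) (v i) = scale ((-1) ^ i) (scale (of_nat i + 1) (upper d v i)
        - scale (of_nat d - of_nat i + 1) (lower v i))" if "i \<le> d" for i
    using half[OF _ _ sign_cases] up[OF that] down[OF that] by (simp add: ladder_def)
  with v show ?thesis by (auto simp: standard_basis_def)
qed

text \<open>On \<open>v i\<close>, going up and back down evaluates the square of b + (-1)^i c as
  4(i + 1)(d - i). Removing the cross term 2(-1)^i a and adding a^2 leaves d(d + 2), independently
  of \<open>i\<close>.\<close>

lemma casimir_scalar:
  assumes v: "standard_basis d a b c v" and abc: "a \<noteq> b" "c \<noteq> a" "c \<noteq> b"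
  shows "act (gen a) (act (gen a) u) + act (gen b) (act (gen b) u) + act (gen c) (act (gen c) u)
    = scale (of_nat d * (of_nat d + 2)) u"
proof -
  let ?\<Omega> = "\<lambda>u. act (gen a) (act (gen a) u) + act (gen b) (act (gen b) u)
    + act (gen c) (act (gen c) u)"
  have basis: "is_basis d v" using v by (simp add: standard_basis_def)
  have \<Omega>: "?\<Omega> (v i) = scale (of_nat d * (of_nat d + 2)) (v i)" if "i \<le> d" for i
  proof -
    have a: "act (gen a) (v i) = scale (theta d i) (v i)"
      using v that by (simp add: standard_basis_def)
    have "ladder b c ((-1) ^ i) (ladder b c ((-1) ^ i) (v i))
      = scale (2 * (of_nat i + 1)) (ladder b c ((-1) ^ i) (upper d v i))"
      by (simp only: standard_basis_up[OF v that] ladder_scale)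
    \<comment> \<open>For \<open>i = d\<close> both sides are 0.\<close>
    also have "ladder b c ((-1) ^ i) (upper d v i) = scale (2 * (of_nat d - of_nat i)) (v i)"
      using standard_basis_down[OF v, of i] that by (auto simp: upper_def ladder_zero)
    also have "scale (2 * (of_nat i + 1)) (scale (2 * (of_nat d - of_nat i)) (v i))
      = scale (4 * (of_nat i + 1) * (of_nat d - of_nat i)) (v i)"
      unfolding scale_scale by (intro arg_cong2[where f=scale]) (simp_all add: algebra_simps)
    finally have "ladder b c ((-1) ^ i) (ladder b c ((-1) ^ i) (v i))
      = scale (4 * (of_nat i + 1) * (of_nat d - of_nat i)) (v i)" .
    then have "act (gen b) (act (gen b) (v i)) + act (gen c) (act (gen c) (v i))
        + scale (2 * (-1) ^ i * theta d i) (v i)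
      = scale (4 * (of_nat i + 1) * (of_nat d - of_nat i)) (v i)"
      using abc by (simp add: ladder_square[of b a c, OF _ _ _ sign_cases] a)
    then have "?\<Omega> (v i) = scale (4 * (of_nat i + 1) * (of_nat d - of_nat i)
        - 2 * (-1) ^ i * theta d i + theta d i * theta d i) (v i)"
      by (simp add: a act_scale scale_left_distrib scale_left_diff_distrib eq_diff_eq[symmetric])
    also have "4 * (of_nat i + 1) * (of_nat d - of_nat i)
        - 2 * (-1) ^ i * theta d i + theta d i * theta d i = of_nat d * (of_nat d + 2)"
      using sign_cases[of i] by (auto simp: theta_def algebra_simps)
    finally show ?thesis .
  qed
  obtain k where u: "u = (\<Sum>i=0..d. scale (k i) (v i))" using basis by (rule is_basis_coords)
  have "?\<Omega> u = (\<Sum>i=0..d. scale (k i) (?\<Omega> (v i)))"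
    unfolding u by (simp add: act_sum act_scale scale_right_distrib sum.distrib)
  also have "\<dots> = scale (of_nat d * (of_nat d + 2)) u"
    unfolding u scale_sum_right by (intro sum.cong) (simp_all add: \<Omega> mult.commute)
  finally show ?thesis .
qed

section \<open>The sum of a standard basis\<close>

lemma sum_shift:
  fixes g h :: "nat \<Rightarrow> 'v"
  assumes "g d = 0" "h 0 = 0" "\<And>i. i < d \<Longrightarrow> g i = h (Suc i)"
  shows "sum g {0..d} = sum h {0..d}"
proof -
  have "sum g {..<Suc d} = sum h {..<Suc d}"
    using assms by (subst (2) sum.lessThan_Suc_shift) simp
  then show ?thesis by (simp add: lessThan_Suc_atMost atLeast0AtMost)
qed

text \<open>The coefficient of \<open>v i\<close> in the image collects terms from
  \<open>v (i - 1)\<close> and \<open>v (i + 1)\<close>: i and d - i under \<open>b\<close>, with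
  sum d; -(-1)^i i and (-1)^i (d - i) under \<open>c\<close>, with sum \<open>theta d i\<close>. The
  second claim says that a - c kills the sum, so the ladder built on it ends below.\<close>

lemma standard_basis_sum:
  assumes v: "standard_basis d a b c v"
  shows "act (gen b) (\<Sum>i=0..d. v i) = scale (of_nat d) (\<Sum>i=0..d. v i)"
    and "act (gen a) (\<Sum>i=0..d. v i) = act (gen c) (\<Sum>i=0..d. v i)"
    and "(\<Sum>i=0..d. v i) \<noteq> 0"
proof -
  have up: "(\<Sum>i=0..d. scale (of_nat i + 1) (upper d v i)) = (\<Sum>i=0..d. scale (of_nat i) (v i))"
    by (rule sum_shift) (auto simp: upper_def add.commute)
  have down: "(\<Sum>i=0..d. scale (of_nat d - of_nat i) (v i)) =
      (\<Sum>i=0..d. scale (of_nat d - of_nat i + 1) (lower v i))"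
    by (rule sum_shift) (auto simp: lower_def)
  have up': "(\<Sum>i=0..d. scale ((-1) ^ i * (of_nat i + 1)) (upper d v i)) =
      (\<Sum>i=0..d. scale (- ((-1) ^ i * of_nat i)) (v i))"
    by (rule sum_shift) (auto simp: upper_def add.commute)
  have down': "(\<Sum>i=0..d. scale (- ((-1) ^ i * (of_nat d - of_nat i))) (v i)) =
      (\<Sum>i=0..d. scale ((-1) ^ i * (of_nat d - of_nat i + 1)) (lower v i))"
    by (rule sum_shift) (auto simp: lower_def)
  have "act (gen b) (\<Sum>i=0..d. v i) =
      (\<Sum>i=0..d. scale (of_nat d - of_nat i + 1) (lower v i) + scale (of_nat i + 1) (upper d v i))"
    using v by (simp add: act_sum standard_basis_def)
  also have "\<dots> = (\<Sum>i=0..d. scale (of_nat d) (v i))"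
    unfolding sum.distrib up down[symmetric] unfolding sum.distrib[symmetric]
    by (simp flip: scale_left_distrib)
  finally show "act (gen b) (\<Sum>i=0..d. v i) = scale (of_nat d) (\<Sum>i=0..d. v i)"
    by (simp add: scale_sum_right)
  have "act (gen c) (\<Sum>i=0..d. v i) = (\<Sum>i=0..d. scale ((-1) ^ i * (of_nat i + 1)) (upper d v i)
      - scale ((-1) ^ i * (of_nat d - of_nat i + 1)) (lower v i))"
    using v by (simp add: act_sum standard_basis_def scale_right_diff_distrib)
  also have "\<dots> = (\<Sum>i=0..d. scale (theta d i) (v i))"
    unfolding sum_subtractf up' down'[symmetric]
    unfolding sum_subtractf[symmetric] scale_left_diff_distrib[symmetric]
    by (intro sum.cong refl arg_cong2[where f=scale]) (simp add: theta_def algebra_simps)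
  also have "\<dots> = act (gen a) (\<Sum>i=0..d. v i)"
    using v by (simp add: act_sum standard_basis_def)
  finally show "act (gen a) (\<Sum>i=0..d. v i) = act (gen c) (\<Sum>i=0..d. v i)" ..
  show "(\<Sum>i=0..d. v i) \<noteq> 0"
    using is_basis_independent[of d v "\<lambda>_. 1" 0] v by (auto simp: standard_basis_def)
qed

section \<open>Permuting the generators\<close>

lemma standard_basis_swap_right:
  assumes v: "standard_basis d a b c v"
  shows "\<exists>w. standard_basis d a c b w"
proof -
  \<comment> \<open>The signs 1, 1, -1, -1, repeated with period 4: their successive quotients
    \<open>(-1) ^ i\<close> absorb the sign in the action of \<open>c\<close> and transfer it to
    \<open>b\<close>.\<close>
  define s :: "nat \<Rightarrow> 'k" where "s i = (\<Prod>k<i. (-1) ^ k)" for i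
  have s_Suc: "s (Suc i) = (-1) ^ i * s i" for i by (simp add: s_def)
  have s_nz: "s i \<noteq> 0" for i by (simp add: s_def)
  let ?w = "\<lambda>i. scale (s i) (v i)"
  have up: "upper d ?w i = scale ((-1) ^ i * s i) (upper d v i)" for i
    by (simp add: upper_def s_Suc)
  have down: "lower ?w i = scale (- ((-1) ^ i * s i)) (lower v i)" for i
    by (cases i) (simp_all add: lower_def s_Suc flip: power_add mult_2)
  have "act (gen c) (?w i) =
      scale (of_nat d - of_nat i + 1) (lower ?w i) + scale (of_nat i + 1) (upper d ?w i) \<and>
    act (gen b) (?w i) = scale ((-1) ^ i) (scale (of_nat i + 1) (upper d ?w i)
        - scale (of_nat d - of_nat i + 1) (lower ?w i))" if "i \<le> d" for i
  proof -
    define L where "L = scale (of_nat d - of_nat i + 1) (lower v i)"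
    define H where "H = scale (of_nat i + 1) (upper d v i)"
    have "act (gen b) (v i) = L + H" "act (gen c) (v i) = scale ((-1) ^ i) (H - L)"
      using v that by (auto simp: standard_basis_def L_def H_def)
    moreover have "scale (of_nat d - of_nat i + 1) (lower ?w i) = scale (- ((-1) ^ i * s i)) L"
      "scale (of_nat i + 1) (upper d ?w i) = scale ((-1) ^ i * s i) H"
      unfolding up down L_def H_def by (rule scale_left_commute)+
    ultimately show ?thesis
      using sign_cases[of i] by (auto simp: act_scale scale_right_distrib scale_right_diff_distrib)
  qed
  moreover have "is_basis d ?w" using v s_nz by (intro is_basis_scale) (auto simp: standard_basis_def)
  ultimately have "standard_basis d a c b ?w"
    using v by (simp add: standard_basis_def act_scale mult.commute)
  then show ?thesis by blast
qed

lemma standard_basis_swap_left: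
  assumes v: "standard_basis d a b c v" and abc: "a \<noteq> b" "c \<noteq> a" "c \<noteq> b"
  shows "\<exists>w. standard_basis d b a c w"
proof -
  \<comment> \<open>The start is the eigenvector of \<open>b\<close> for \<open>theta d 0\<close>;
    the factors are chosen so that the raising condition of \<open>standard_basisI\<close>
    holds.\<close>
  define w where "w = rec_nat (\<Sum>i=0..d. v i)
    (\<lambda>i u. scale (1 / (2 * (of_nat i + 1))) (ladder a c ((-1) ^ i) u))"
  have w_0: "w 0 = (\<Sum>i=0..d. v i)"
    and w_Suc: "w (Suc i) = scale (1 / (2 * (of_nat i + 1))) (ladder a c ((-1) ^ i) (w i))" for i
    by (simp_all add: w_def)
  have nz: "2 * (of_nat i + 1) \<noteq> (0 :: 'k)" for i
    using of_nat_eq_0_iff[of "2 * Suc i", where 'a='k] by (simp add: algebra_simps)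
  have even: "even d" and basis: "is_basis d v" using v by (auto simp: standard_basis_def)
  have up: "ladder a c ((-1) ^ i) (w i) = scale (2 * (of_nat i + 1)) (w (Suc i))" for i
    using nz[of i] by (simp add: w_Suc del: distrib_left_numeral)
  have eig: "act (gen b) (w i) = scale (theta d i) (w i)" for i
  proof (induction i)
    case 0
    then show ?case using standard_basis_sum(1)[OF v] by (simp add: w_0 theta_def)
  next
    case (Suc i)
    from ladder_eigenvector[OF abc Suc sign_cases] show ?case
      by (simp add: w_Suc act_scale theta_Suc mult.commute)
  qed
  \<comment> \<open>The vector \<open>w (Suc i)\<close> is a multiple of a ladder image of
    \<open>w i\<close>, so the squared ladder operator acts on \<open>w i\<close>. The Casimir
    scalar evaluates it as 4(i + 1)(d - i), from which 2(i + 1) cancels.\<close>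
  have down: "ladder a c ((-1) ^ i) (w (Suc i)) = scale (2 * (of_nat d - of_nat i)) (w i)" for i
  proof -
    have "scale (2 * (of_nat i + 1)) (ladder a c ((-1) ^ i) (w (Suc i)))
      = ladder a c ((-1) ^ i) (ladder a c ((-1) ^ i) (w i))"
      by (simp add: up ladder_scale)
    also have "\<dots> = scale (of_nat d * (of_nat d + 2)) (w i) - act (gen b) (act (gen b) (w i))
        + scale (2 * (-1) ^ i) (act (gen b) (w i))"
      unfolding ladder_square[OF abc sign_cases] casimir_scalar[OF v abc, symmetric] by simp
    also have "\<dots> = scale (of_nat d * (of_nat d + 2) - theta d i * theta d i
        + 2 * (-1) ^ i * theta d i) (w i)"
      by (simp add: eig act_scale scale_left_distrib scale_left_diff_distrib)
    also have "of_nat d * (of_nat d + 2) - theta d i * theta d i + 2 * (-1) ^ i * theta d i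
        = 2 * (of_nat i + 1) * (2 * (of_nat d - of_nat i))"
      using sign_cases[of i] by (auto simp: theta_def algebra_simps)
    finally have "scale (2 * (of_nat i + 1)) (ladder a c ((-1) ^ i) (w (Suc i)))
      = scale (2 * (of_nat i + 1)) (scale (2 * (of_nat d - of_nat i)) (w i))"
      by (simp only: scale_scale)
    then show ?thesis by (rule scale_left_imp_eq[OF nz])
  qed
  have w_nz: "w i \<noteq> 0" if "i \<le> d" for i
    using that
  proof (induction i)
    case 0
    show ?case using standard_basis_sum(3)[OF v] by (simp add: w_0)
  next
    case (Suc i)
    \<comment> \<open>Below \<open>d\<close> the factor in \<open>down\<close> is nonzero, so a
      vanishing \<open>w (Suc i)\<close> would force \<open>w i = 0\<close>.\<close>
    then have "of_nat d - of_nat i \<noteq> (0 :: 'k)" by simp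
    with Suc down[of i] show ?case by (auto simp: ladder_zero)
  qed
  have eb: "eigenbasis d b w" by (rule eigenbasisI[OF even basis w_nz eig])
  \<comment> \<open>The ladder stops at \<open>d\<close>: the next eigenvalue would be
    \<open>theta d (Suc d)\<close>, that is d + 2, which does not occur.\<close>
  have "theta d (Suc d) \<noteq> theta d i" if "i \<le> d" for i
    using injD[OF theta_inj[OF even], of "Suc d" i] that by auto
  from eigenvector_zero[OF eb eig this] have top: "w (Suc d) = 0" by simp
  have "standard_basis d b a c w"
  proof (rule standard_basisI)
    show "ladder a c ((-1) ^ i) (w i) = scale (2 * (of_nat i + 1)) (upper d w i)" for i
      using up[of i] by (auto simp: upper_def top)
    show "ladder a c (- ((-1) ^ i)) (w i) = scale (2 * (of_nat d - of_nat i + 1)) (lower w i)" for i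
    \<comment> \<open>The sign -(-1)^i is the one of \<open>down\<close> at the preceding index. For
      \<open>i = 0\<close> the operator is a - c, which kills \<open>w 0\<close>.\<close>
    proof (cases i)
      case 0
      then show ?thesis using standard_basis_sum(2)[OF v] by (simp add: ladder_def lower_def w_0)
    next
      case (Suc j)
      then show ?thesis using down[of j] by (simp add: lower_def)
    qed
  qed (use even eb eig in \<open>auto simp: eigenbasis_def\<close>)
  then show ?thesis by blast
qed

lemma standard_basis_exists:
  assumes "type_B d" "a \<noteq> b" "c \<noteq> a" "c \<noteq> b"
  shows "\<exists>v. standard_basis d a b c v"
proof -
  let ?S = "\<lambda>a b c. \<exists>v. standard_basis d a b c v"
  have right: "?S a c b" if "?S a b c" for a b c
    using that standard_basis_swap_right by blast
  have left: "?S b a c" if "?S a b c" "a \<noteq> b" "c \<noteq> a" "c \<noteq> b" for a b c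
    using that standard_basis_swap_left by blast
  \<comment> \<open>The two adjacent swaps generate all six orderings.\<close>
  have xyz: "?S Gx Gy Gz" using assms(1) by (rule type_B_standard_basis)
  have xzy: "?S Gx Gz Gy" by (rule right[OF xyz])
  have yxz: "?S Gy Gx Gz" by (rule left[OF xyz]) simp_all
  have zxy: "?S Gz Gx Gy" by (rule left[OF xzy]) simp_all
  show ?thesis
    using assms xyz xzy yxz zxy right[OF yxz] right[OF zxy]
    by (cases a; cases b; cases c; simp)
qed

section \<open>Matrices with respect to a standard basis\<close>

lemma tridiagonal_sum:
  assumes "j \<le> d"
  shows "(\<Sum>i=0..d. scale (if j = i + 1 then p i else if i = j + 1 then q i else 0) (v i))
    = scale (p (j - 1)) (lower v j) + scale (q (j + 1)) (upper d v j)"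
proof -
  have "(\<Sum>i=0..d. scale (if j = i + 1 then p i else if i = j + 1 then q i else 0) (v i))
    = (\<Sum>i=0..d. (if i = j - 1 then scale (p i) (lower v j) else 0)
      + (if i = j + 1 then scale (q i) (upper d v j) else 0))"
    using assms by (intro sum.cong) (auto simp: lower_def upper_def)
  also have "\<dots> = scale (p (j - 1)) (lower v j) + scale (q (j + 1)) (upper d v j)"
    using assms by (auto simp: sum.distrib upper_def)
  finally show ?thesis .
qed

lemma standard_basis_represents:
  assumes v: "standard_basis d a b c v"
  shows "represents d (\<lambda>i j. if i = j then (-1) ^ i * (of_nat d - 2 * of_nat i) else 0)
      (act (gen a)) v" (is ?A)
    and "represents d (\<lambda>i j. if j = i + 1 then of_nat d - of_nat j + 1
      else if i = j + 1 then of_nat i else 0) (act (gen b)) v" (is ?B)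
    and "represents d (\<lambda>i j. if j = i + 1 then (-1) ^ (j - 1) * (of_nat d - of_nat j + 1)
      else if i = j + 1 then (-1) ^ (i - 1) * of_nat i else 0) (act (gen c)) v" (is ?C)
proof -
  show ?A using v
    by (simp add: represents_def standard_basis_def theta_def if_distrib[of "\<lambda>k. scale k _"]
        cong: if_cong)
  show ?B unfolding represents_def
  proof (intro allI impI)
    fix j assume j: "j \<le> d"
    with v show "act (gen b) (v j) = (\<Sum>i=0..d. scale (if j = i + 1 then of_nat d - of_nat j + 1
        else if i = j + 1 then of_nat i else 0) (v i))"
      unfolding tridiagonal_sum[OF j] by (simp add: standard_basis_def add.commute)
  qed
  show ?C unfolding represents_def
  proof (intro allI impI)
    fix j assume j: "j \<le> d"
    \<comment> \<open>For \<open>j = 0\<close> the two signs do not match, but they then multiply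
      0.\<close>
    have sign: "scale ((-1) ^ (j - 1) * k) (lower v j) = - scale ((-1) ^ j * k) (lower v j)" for k
      by (cases j) (simp_all add: lower_def)
    from j v show "act (gen c) (v j) = (\<Sum>i=0..d. scale (if j = i + 1
        then (-1) ^ (j - 1) * (of_nat d - of_nat j + 1)
        else if i = j + 1 then (-1) ^ (i - 1) * of_nat i else 0) (v i))"
      unfolding tridiagonal_sum[OF j] sign
      by (simp add: standard_basis_def add.commute scale_right_diff_distrib)
  qed
qed

section \<open>From standard bases to the idempotent images\<close>

lemma standard_basis_multiple:
  assumes v: "standard_basis d a b c v" and "k \<noteq> 0" and u: "\<And>i. i \<le> d \<Longrightarrow> u i = scale k (v i)"
  shows "standard_basis d a b c u"
proof -
  have "is_basis d (\<lambda>i. scale k (v i))"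
    using v \<open>k \<noteq> 0\<close> by (intro is_basis_scale) (simp_all add: standard_basis_def)
  moreover have "u ` {0..d} = (\<lambda>i. scale k (v i)) ` {0..d}"
    using u by (intro image_cong) auto
  moreover have "inj_on u {0..d} \<longleftrightarrow> inj_on (\<lambda>i. scale k (v i)) {0..d}"
    using u by (intro inj_on_cong) auto
  ultimately have "is_basis d u" by (simp add: is_basis_def)
  moreover have "lower u i = scale k (lower v i)" "upper d u i = scale k (upper d v i)" if "i \<le> d" for i
    using u that by (auto simp: lower_def upper_def)
  ultimately show ?thesis
    using v u unfolding standard_basis_def
    by (auto simp: act_scale scale_right_distrib scale_right_diff_distrib mult.commute mult.left_commute)
qed

text \<open>Both \<open>vb\<close> and the sum of a standard basis \<open>v\<close> are nonzero
  vectors on the \<open>theta d 0\<close> eigenline of \<open>b\<close>. So \<open>vb\<close> is m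
  times that sum, and the i-th idempotent of \<open>a\<close> cuts out m times
  \<open>v i\<close>.\<close>

lemma prim_idem_standard_basis:
  assumes "type_B d" "a \<noteq> b" "c \<noteq> a" "c \<noteq> b" "vb \<in> range (prim_idem d b 0)" "vb \<noteq> 0"
  shows "standard_basis d a b c (\<lambda>i. prim_idem d a i vb)"
proof -
  interpret vector_space_pair scale scale ..
  obtain v where v: "standard_basis d a b c v"
    using standard_basis_exists[OF assms(1-4)] by blast
  \<comment> \<open>The ordering \<open>(b, a, c)\<close> supplies an eigenbasis of
    \<open>b\<close>, on which its idempotent can be computed.\<close>
  obtain w where "standard_basis d b a c w"
    using standard_basis_exists[of d b a c] assms(1-4) by auto
  then have w: "eigenbasis d b w" by (rule standard_basis_eigenbasis)
  note E = prim_idem_eigenbasis[OF w, of 0, simplified]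
  obtain x where x: "vb = prim_idem d b 0 x" using assms(5) by blast
  obtain k where k: "x = (\<Sum>i=0..d. scale (k i) (w i))"
    using w is_basis_coords unfolding eigenbasis_def by blast
  have "vb = (\<Sum>i=0..d. scale (k i) (if i = 0 then w 0 else 0))"
    unfolding x k linear_sum[OF E(1)] linear_scale[OF E(1)] by (simp add: E(2))
  also have "\<dots> = (\<Sum>i=0..d. if i = 0 then scale (k 0) (w 0) else 0)"
    by (intro sum.cong) auto
  finally have vb: "vb = scale (k 0) (w 0)" by simp
  obtain l where l: "(\<Sum>i=0..d. v i) = scale l (w 0)"
    using eigenvector_line[OF w, of _ 0] standard_basis_sum(1)[OF v] by (auto simp: theta_def)
  have "l \<noteq> 0" using standard_basis_sum(3)[OF v] l by auto
  define m where "m = k 0 / l"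
  have "m \<noteq> 0" using vb assms(6) \<open>l \<noteq> 0\<close> by (auto simp: m_def)
  have vb': "vb = scale m (\<Sum>i=0..d. v i)"
    using \<open>l \<noteq> 0\<close> by (simp add: vb l m_def)
  show ?thesis using v \<open>m \<noteq> 0\<close>
  proof (rule standard_basis_multiple)
    fix i assume i: "i \<le> d"
    note E = prim_idem_eigenbasis[OF standard_basis_eigenbasis[OF v] i]
    show "prim_idem d a i vb = scale m (v i)"
      unfolding vb' linear_scale[OF E(1)] linear_sum[OF E(1)] using i by (simp add: E(2))
  qed
qed

end

theorem theorem7p2:
  fixes act :: "'k::{alg_closed_field, field_char_0} asa \<Rightarrow> 'v::ab_group_add \<Rightarrow> 'v"
    and d :: nat and a b c :: gen and vb :: 'v
  assumes "asa_module act"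
    and "asa_module.finite_dimensional act"
    and "asa_module.irreducible act"
    and "asa_module.type_B act d"
    and "a \<noteq> b" and "c \<noteq> a" and "c \<noteq> b"
    and "vb \<in> range (asa_module.prim_idem act d b 0)" and "vb \<noteq> 0"
  shows "let u = (\<lambda>i. asa_module.prim_idem act d a i vb) in
    asa_module.is_basis act d u
    \<and> asa_module.represents act d
        (\<lambda>i j. if i = j then (-1) ^ i * (of_nat d - 2 * of_nat i) else 0)
        (act (gen a)) u
    \<and> asa_module.represents act d
        (\<lambda>i j. if j = i + 1 then of_nat d - of_nat j + 1
               else if i = j + 1 then of_nat i
               else 0)
        (act (gen b)) u
    \<and> asa_module.represents act d
        (\<lambda>i j. if j = i + 1 then (-1) ^ (j - 1) * (of_nat d - of_nat j + 1)
               else if i = j + 1 then (-1) ^ (i - 1) * of_nat i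
               else 0)
        (act (gen c)) u"
proof -
  interpret asa_module act by fact
  interpret asa_module_char_0 act ..
  have u: "standard_basis d a b c (\<lambda>i. prim_idem d a i vb)"
    using assms by (intro prim_idem_standard_basis)
  then have "is_basis d (\<lambda>i. prim_idem d a i vb)" by (simp add: standard_basis_def)
  with standard_basis_represents[OF u] show ?thesis unfolding Let_def by (intro conjI)
qed

end
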